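(* Let $M$ be a spacetime with a class $\mathcal{R}(M)$ of admissible regions, embedding category $\mathbf{Emb}(M)$ and wide subcategory of inclusions $\mathbf{Inc}(M)\subseteq\mathbf{Emb}(M)$. Then $\mathbf{Mink}(M)$ is a strict double category.
   Context: Fix a spacetime $M$ and a class $\mathcal{R}(M)$ of admissible regions of $M$. $\mathbf{Emb}(M)$ is the category whose objects are the regions $U\in\mathcal{R}(M)$ and whose morphisms are the admissible embeddings $h:U\hookrightarrow V$ (identities are admissible and admissible embeddings are closed under composition). $\mathbf{Inc}(M)\subseteq\mathbf{Emb}(M)$ is the wide subcategory of inclusions. $\mathbf{Mink}(M)$ is given by the following data. (a) $\mathbf{Mink}(M)_0:=\mathbf{Inc}(M)$: objects are regions and vertical morphisms are inclusions. (b) Horizontal morphisms $U\Rightarrow V$ are the admissible embeddings $h:U\hookrightarrow V$, i.e. the morphisms of $\mathbf{Emb}(M)$. (c) A square from $h:U\hookrightarrow V$ to $h':U'\hookrightarrow V'$ with vertical boundary inclusions $i:U\hookrightarrow U'$ and $j:V\hookrightarrow V'$ is a commuting square in $\mathbf{Emb}(M)$, i.e. $j\circ h=h'\circ i$. (d) Horizontal composition is composition in $\mathbf{Emb}(M)$; vertical composition is composition in $\mathbf{Inc}(M)$; squares compose by pasting commuting squares. (e) Horizontal identities are the identity embeddings $\mathrm{id}_U$; the unit square on an inclusion $i:U\hookrightarrow U'$ is the commuting square with horizontal sides $\mathrm{id}_U,\mathrm{id}_{U'}$ and both vertical sides $i$. A strict double category is a category internal to $\mathbf{Cat}$: categories $\mathbb{D}_0$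 (objects, vertical morphisms) and $\mathbb{D}_1$ (horizontal morphisms, squares) with source and target functors $s,t:\mathbb{D}_1\rightrightarrows\mathbb{D}_0$, an identity functor $\mathbb{D}_0\to\mathbb{D}_1$ and a horizontal composition functor $\mathbb{D}_1\times_{\mathbb{D}_0}\mathbb{D}_1\to\mathbb{D}_1$, strictly associative and unital. *)

theory Defs
  imports "HOL-Analysis.Abstract_Topology" "HOL-Library.FuncSet"
begin

section \<open>Categories and functors\<close>

text \<open>\<open>Comp C g f\<close> is "\<open>g\<close> after \<open>f\<close>", meaningful only when \<open>Cod C f = Dom C g\<close>.  All data are constrained on \<open>Obj C\<close> and \<open>Arr C\<close> only.\<close>

record ('o, 'm) cat =
  Obj :: "'o set"
  Arr :: "'m set"
  Dom :: "'m \<Rightarrow> 'o"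
  Cod :: "'m \<Rightarrow> 'o"
  Id :: "'o \<Rightarrow> 'm"
  Comp :: "'m \<Rightarrow> 'm \<Rightarrow> 'm"

locale category =
  fixes C :: "('o, 'm) cat"
  assumes dom_obj: "f \<in> Arr C \<Longrightarrow> Dom C f \<in> Obj C"
    and cod_obj: "f \<in> Arr C \<Longrightarrow> Cod C f \<in> Obj C"
    and id_arr: "x \<in> Obj C \<Longrightarrow> Id C x \<in> Arr C"
    and dom_id: "x \<in> Obj C \<Longrightarrow> Dom C (Id C x) = x"
    and cod_id: "x \<in> Obj C \<Longrightarrow> Cod C (Id C x) = x"
    and comp_arr: "\<lbrakk>f \<in> Arr C; g \<in> Arr C; Cod C f = Dom C g\<rbrakk> \<Longrightarrow> Comp C g f \<in> Arr C"
    and dom_comp: "\<lbrakk>f \<in> Arr C; g \<in> Arr C; Cod C f = Dom C g\<rbrakk> \<Longrightarrow> Dom C (Comp C g f) = Dom C f"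
    and cod_comp: "\<lbrakk>f \<in> Arr C; g \<in> Arr C; Cod C f = Dom C g\<rbrakk> \<Longrightarrow> Cod C (Comp C g f) = Cod C g"
    and comp_id_right: "f \<in> Arr C \<Longrightarrow> Comp C f (Id C (Dom C f)) = f"
    and comp_id_left: "f \<in> Arr C \<Longrightarrow> Comp C (Id C (Cod C f)) f = f"
    and comp_assoc: "\<lbrakk>f \<in> Arr C; g \<in> Arr C; h \<in> Arr C; Cod C f = Dom C g; Cod C g = Dom C h\<rbrakk>
      \<Longrightarrow> Comp C h (Comp C g f) = Comp C (Comp C h g) f"

record ('o1, 'm1, 'o2, 'm2) fun_data =
  on_obj :: "'o1 \<Rightarrow> 'o2"
  on_arr :: "'m1 \<Rightarrow> 'm2"

locale cat_functor = A: category A + B: category B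
  for A :: "('o1, 'm1) cat" and B :: "('o2, 'm2) cat" +
  fixes F :: "('o1, 'm1, 'o2, 'm2) fun_data"
  assumes map_obj: "x \<in> Obj A \<Longrightarrow> on_obj F x \<in> Obj B"
    and map_arr: "f \<in> Arr A \<Longrightarrow> on_arr F f \<in> Arr B"
    and map_dom: "f \<in> Arr A \<Longrightarrow> Dom B (on_arr F f) = on_obj F (Dom A f)"
    and map_cod: "f \<in> Arr A \<Longrightarrow> Cod B (on_arr F f) = on_obj F (Cod A f)"
    and map_id: "x \<in> Obj A \<Longrightarrow> on_arr F (Id A x) = Id B (on_obj F x)"
    and map_comp: "\<lbrakk>f \<in> Arr A; g \<in> Arr A; Cod A f = Dom A g\<rbrakk>
      \<Longrightarrow> on_arr F (Comp A g f) = Comp B (on_arr F g) (on_arr F f)"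

text \<open>The strict pullback \<open>A \<times>\<^sub>E B\<close> of \<open>F : A \<rightarrow> E\<close> and \<open>G : B \<rightarrow> E\<close> in \<open>Cat\<close>.\<close>

definition pullback_cat ::
  "('o1, 'm1) cat \<Rightarrow> ('o1, 'm1, 'o, 'm) fun_data \<Rightarrow> ('o2, 'm2, 'o, 'm) fun_data \<Rightarrow> ('o2, 'm2) cat
    \<Rightarrow> ('o1 \<times> 'o2, 'm1 \<times> 'm2) cat"
  where "pullback_cat A F G B =
    \<lparr> Obj = {(x, y). x \<in> Obj A \<and> y \<in> Obj B \<and> on_obj F x = on_obj G y},
      Arr = {(f, g). f \<in> Arr A \<and> g \<in> Arr B \<and> on_arr F f = on_arr G g},
      Dom = (\<lambda>(f, g). (Dom A f, Dom B g)),
      Cod = (\<lambda>(f, g). (Cod A f, Cod B g)),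
      Id = (\<lambda>(x, y). (Id A x, Id B y)),
      Comp = (\<lambda>(f', g') (f, g). (Comp A f' f, Comp B g' g)) \<rparr>"

section \<open>Strict double categories\<close>

record ('o, 'v, 'h, 'q) dbl_data =
  D0 :: "('o, 'v) cat"
  D1 :: "('h, 'q) cat"
  src :: "('h, 'q, 'o, 'v) fun_data"
  tgt :: "('h, 'q, 'o, 'v) fun_data"
  unit :: "('o, 'v, 'h, 'q) fun_data"
  hcomp :: "('h \<times> 'h, 'q \<times> 'q, 'h, 'q) fun_data"

text \<open>A category internal to \<open>Cat\<close>.  A pair \<open>(k, h)\<close> is composable when \<open>s k = t h\<close>, and
  \<open>hcomp\<close> sends it to "\<open>k\<close> after \<open>h\<close>".  Each equation between functors is stated as an equation
  on objects and an equation on arrows.\<close>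

locale strict_double_category =
  D0: category "D0 D" + D1: category "D1 D" +
  s: cat_functor "D1 D" "D0 D" "src D" +
  t: cat_functor "D1 D" "D0 D" "tgt D" +
  i: cat_functor "D0 D" "D1 D" "unit D" +
  c: cat_functor "pullback_cat (D1 D) (src D) (tgt D) (D1 D)" "D1 D" "hcomp D"
  for D :: "('o, 'v, 'h, 'q) dbl_data" +
  assumes src_unit_obj: "x \<in> Obj (D0 D) \<Longrightarrow> on_obj (src D) (on_obj (unit D) x) = x"
    and src_unit_arr: "u \<in> Arr (D0 D) \<Longrightarrow> on_arr (src D) (on_arr (unit D) u) = u"
    and tgt_unit_obj: "x \<in> Obj (D0 D) \<Longrightarrow> on_obj (tgt D) (on_obj (unit D) x) = x"
    and tgt_unit_arr: "u \<in> Arr (D0 D) \<Longrightarrow> on_arr (tgt D) (on_arr (unit D) u) = u"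
    and src_hcomp_obj: "\<lbrakk>h \<in> Obj (D1 D); k \<in> Obj (D1 D); on_obj (src D) k = on_obj (tgt D) h\<rbrakk>
      \<Longrightarrow> on_obj (src D) (on_obj (hcomp D) (k, h)) = on_obj (src D) h"
    and src_hcomp_arr: "\<lbrakk>a \<in> Arr (D1 D); b \<in> Arr (D1 D); on_arr (src D) b = on_arr (tgt D) a\<rbrakk>
      \<Longrightarrow> on_arr (src D) (on_arr (hcomp D) (b, a)) = on_arr (src D) a"
    and tgt_hcomp_obj: "\<lbrakk>h \<in> Obj (D1 D); k \<in> Obj (D1 D); on_obj (src D) k = on_obj (tgt D) h\<rbrakk>
      \<Longrightarrow> on_obj (tgt D) (on_obj (hcomp D) (k, h)) = on_obj (tgt D) k"
    and tgt_hcomp_arr: "\<lbrakk>a \<in> Arr (D1 D); b \<in> Arr (D1 D); on_arr (src D) b = on_arr (tgt D) a\<rbrakk>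
      \<Longrightarrow> on_arr (tgt D) (on_arr (hcomp D) (b, a)) = on_arr (tgt D) b"
    and hcomp_assoc_obj: "\<lbrakk>h \<in> Obj (D1 D); k \<in> Obj (D1 D); l \<in> Obj (D1 D);
        on_obj (src D) k = on_obj (tgt D) h; on_obj (src D) l = on_obj (tgt D) k\<rbrakk>
      \<Longrightarrow> on_obj (hcomp D) (l, on_obj (hcomp D) (k, h))
        = on_obj (hcomp D) (on_obj (hcomp D) (l, k), h)"
    and hcomp_assoc_arr: "\<lbrakk>a \<in> Arr (D1 D); b \<in> Arr (D1 D); d \<in> Arr (D1 D);
        on_arr (src D) b = on_arr (tgt D) a; on_arr (src D) d = on_arr (tgt D) b\<rbrakk>
      \<Longrightarrow> on_arr (hcomp D) (d, on_arr (hcomp D) (b, a))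
        = on_arr (hcomp D) (on_arr (hcomp D) (d, b), a)"
    and hcomp_unit_right_obj: "h \<in> Obj (D1 D)
      \<Longrightarrow> on_obj (hcomp D) (h, on_obj (unit D) (on_obj (src D) h)) = h"
    and hcomp_unit_right_arr: "a \<in> Arr (D1 D)
      \<Longrightarrow> on_arr (hcomp D) (a, on_arr (unit D) (on_arr (src D) a)) = a"
    and hcomp_unit_left_obj: "h \<in> Obj (D1 D)
      \<Longrightarrow> on_obj (hcomp D) (on_obj (unit D) (on_obj (tgt D) h), h) = h"
    and hcomp_unit_left_arr: "a \<in> Arr (D1 D)
      \<Longrightarrow> on_arr (hcomp D) (on_arr (unit D) (on_arr (tgt D) a), a) = a"

section \<open>Regions and admissible embeddings of a spacetime\<close>

text \<open>Only the underlying topological space \<open>M\<close> of the spacetime enters; any further structure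
  (metric, causal order, time orientation) is felt through the class \<open>R\<close> of admissible regions and
  the sets \<open>A U V\<close> of admissible embeddings \<open>U \<hookrightarrow> V\<close>, which are arbitrary subject to the closure
  conditions.  Maps out of \<open>U\<close> are extensional (\<open>undefined\<close> off \<open>U\<close>), so that equality of HOL
  functions is equality of maps on \<open>U\<close>.\<close>

locale spacetime_regions =
  fixes M :: "'a topology" and R :: "'a set set" and A :: "'a set \<Rightarrow> 'a set \<Rightarrow> ('a \<Rightarrow> 'a) set"
  assumes region_subset: "U \<in> R \<Longrightarrow> U \<subseteq> topspace M"
    and admissible_map: "\<lbrakk>U \<in> R; V \<in> R; h \<in> A U V\<rbrakk> \<Longrightarrow> h \<in> U \<rightarrow>\<^sub>E V"
    and admissible_embedding: "\<lbrakk>U \<in> R; V \<in> R; h \<in> A U V\<rbrakk>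
      \<Longrightarrow> embedding_map (subtopology M U) (subtopology M V) h"
    and admissible_id: "U \<in> R \<Longrightarrow> (\<lambda>x\<in>U. x) \<in> A U U"
    and admissible_comp: "\<lbrakk>U \<in> R; V \<in> R; W \<in> R; h \<in> A U V; k \<in> A V W\<rbrakk> \<Longrightarrow> compose U k h \<in> A U W"

datatype 'a emb = Emb_arr (emb_dom: "'a set") (emb_map: "'a \<Rightarrow> 'a") (emb_cod: "'a set")

definition Emb :: "'a set set \<Rightarrow> ('a set \<Rightarrow> 'a set \<Rightarrow> ('a \<Rightarrow> 'a) set) \<Rightarrow> ('a set, 'a emb) cat"
  where "Emb R A =
    \<lparr> Obj = R,
      Arr = {Emb_arr U h V | U h V. U \<in> R \<and> V \<in> R \<and> h \<in> A U V},
      Dom = emb_dom,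
      Cod = emb_cod,
      Id = (\<lambda>U. Emb_arr U (\<lambda>x\<in>U. x) U),
      Comp = (\<lambda>k h. Emb_arr (emb_dom h) (compose (emb_dom h) (emb_map k) (emb_map h)) (emb_cod k)) \<rparr>"

definition is_inclusion :: "'a emb \<Rightarrow> bool"
  where "is_inclusion f \<longleftrightarrow> emb_dom f \<subseteq> emb_cod f \<and> emb_map f = (\<lambda>x\<in>emb_dom f. x)"

definition Inc :: "'a set set \<Rightarrow> ('a set \<Rightarrow> 'a set \<Rightarrow> ('a \<Rightarrow> 'a) set) \<Rightarrow> ('a set, 'a emb) cat"
  where "Inc R A = (Emb R A)\<lparr> Arr := {f \<in> Arr (Emb R A). is_inclusion f} \<rparr>"

section \<open>The double category of a spacetime\<close>

text \<open>A square has its horizontal sides \<open>h : U \<hookrightarrow> V\<close> (top) and \<open>h' : U' \<hookrightarrow> V'\<close> (bottom), and its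
  vertical sides \<open>i : U \<hookrightarrow> U'\<close> (left) and \<open>j : V \<hookrightarrow> V'\<close> (right).\<close>

datatype 'm square =
  Square (sq_top: 'm) (sq_bottom: 'm) (sq_left: 'm) (sq_right: 'm)

definition Mink_squares ::
  "'a set set \<Rightarrow> ('a set \<Rightarrow> 'a set \<Rightarrow> ('a \<Rightarrow> 'a) set) \<Rightarrow> 'a emb square set"
  where "Mink_squares R A =
    {Square h h' i j | h h' i j.
      h \<in> Arr (Emb R A) \<and> h' \<in> Arr (Emb R A) \<and> i \<in> Arr (Inc R A) \<and> j \<in> Arr (Inc R A) \<and>
      Dom (Emb R A) i = Dom (Emb R A) h \<and> Cod (Emb R A) i = Dom (Emb R A) h' \<and>
      Dom (Emb R A) j = Cod (Emb R A) h \<and> Cod (Emb R A) j = Cod (Emb R A) h' \<and>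
      Comp (Emb R A) j h = Comp (Emb R A) h' i}"

definition Mink1 ::
  "'a set set \<Rightarrow> ('a set \<Rightarrow> 'a set \<Rightarrow> ('a \<Rightarrow> 'a) set) \<Rightarrow> ('a emb, 'a emb square) cat"
  where "Mink1 R A =
    \<lparr> Obj = Arr (Emb R A),
      Arr = Mink_squares R A,
      Dom = sq_top,
      Cod = sq_bottom,
      Id = (\<lambda>h. Square h h (Id (Inc R A) (Dom (Emb R A) h)) (Id (Inc R A) (Cod (Emb R A) h))),
      Comp = (\<lambda>b a. Square (sq_top a) (sq_bottom b)
        (Comp (Inc R A) (sq_left b) (sq_left a)) (Comp (Inc R A) (sq_right b) (sq_right a))) \<rparr>"

definition Mink ::
  "'a set set \<Rightarrow> ('a set \<Rightarrow> 'a set \<Rightarrow> ('a \<Rightarrow> 'a) set)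
    \<Rightarrow> ('a set, 'a emb, 'a emb, 'a emb square) dbl_data"
  where "Mink R A =
    \<lparr> D0 = Inc R A,
      D1 = Mink1 R A,
      src = \<lparr> on_obj = Dom (Emb R A), on_arr = sq_left \<rparr>,
      tgt = \<lparr> on_obj = Cod (Emb R A), on_arr = sq_right \<rparr>,
      unit = \<lparr> on_obj = Id (Emb R A),
        on_arr = (\<lambda>i. Square (Id (Emb R A) (Dom (Inc R A) i)) (Id (Emb R A) (Cod (Inc R A) i)) i i) \<rparr>,
      hcomp = \<lparr> on_obj = (\<lambda>(k, h). Comp (Emb R A) k h),
        on_arr = (\<lambda>(b, a). Square (Comp (Emb R A) (sq_top b) (sq_top a))
          (Comp (Emb R A) (sq_bottom b) (sq_bottom a)) (sq_left a) (sq_right b)) \<rparr> \<rparr>"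

end

theory Submission
  imports Defs
begin

text \<open>A square is just four sides in \<open>Emb R A\<close> subject to boundary conditions and
  one commutation equation, so squares with equal sides are equal. Every law of a double category
  therefore reduces to identities between sides, which follow from associativity and unit laws in
  \<open>Emb R A\<close>. Interchange is automatic: both ways of composing a two-by-two grid give
  the same four sides. What remains is closure. Identity and unit squares commute
  (\<open>identity_square\<close>, \<open>unit_square\<close>), and two commuting squares glued
  along a common side paste to a commuting square (\<open>paste_vertical\<close>,
  \<open>paste_horizontal\<close>). Underneath, \<open>Emb R A\<close> is a category
  (\<open>category_Emb\<close>), and inclusions include the identities and are closed under
  composition (\<open>id_Inc\<close>, \<open>comp_Inc\<close>).\<close>

lemma category_pullback_cat:
  assumes "cat_functor A E F" and "cat_functor B E G"
  shows "category (pullback_cat A F G B)"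
proof -
  interpret F: cat_functor A E F by (fact assms(1))
  interpret G: cat_functor B E G by (fact assms(2))
  show ?thesis
  proof (unfold_locales, goal_cases)
    \<comment> \<open>Both components of an arrow of the pullback have the same image in
      \<open>E\<close>. Reading \<open>map_dom\<close> backwards turns the required equality of
      objects into equality of the domains of that common image.\<close>
    case (1 f) then show ?case
      by (auto simp: pullback_cat_def F.A.dom_obj G.A.dom_obj simp flip: F.map_dom G.map_dom)
  next
    case (2 f) then show ?case
      by (auto simp: pullback_cat_def F.A.cod_obj G.A.cod_obj simp flip: F.map_cod G.map_cod)
  next
    case (3 x) then show ?case
      by (auto simp: pullback_cat_def F.A.id_arr G.A.id_arr F.map_id G.map_id)
  next
    case (6 f g) then show ?case
      by (auto simp: pullback_cat_def F.A.comp_arr G.A.comp_arr F.map_comp G.map_comp)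
  qed (auto simp: pullback_cat_def F.A.dom_id F.A.cod_id F.A.dom_comp F.A.cod_comp
      F.A.comp_id_right F.A.comp_id_left F.A.comp_assoc
      G.A.dom_id G.A.cod_id G.A.dom_comp G.A.cod_comp
      G.A.comp_id_right G.A.comp_id_left G.A.comp_assoc)
qed

text \<open>Passing to the wide subcategory changes only the arrow set, so equations in
  \<open>Inc R A\<close> can be settled in \<open>Emb R A\<close>.\<close>

lemma Inc_sel [simp]:
  "Obj (Inc R A) = Obj (Emb R A)" "Dom (Inc R A) = Dom (Emb R A)" "Cod (Inc R A) = Cod (Emb R A)"
  "Id (Inc R A) = Id (Emb R A)" "Comp (Inc R A) = Comp (Emb R A)"
  by (simp_all add: Inc_def Emb_def)

context spacetime_regions
begin

text \<open>Extensionality of \<open>h\<close> makes the two sides agree off \<open>U\<close> as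
  well; the left law also uses that \<open>h\<close> takes values in \<open>V\<close>.\<close>

lemma compose_id_right: "\<lbrakk>U \<in> R; V \<in> R; h \<in> A U V\<rbrakk> \<Longrightarrow> compose U h (\<lambda>x\<in>U. x) = h"
  and compose_id_left: "\<lbrakk>U \<in> R; V \<in> R; h \<in> A U V\<rbrakk> \<Longrightarrow> compose U (\<lambda>x\<in>V. x) h = h"
  using admissible_map[of U V h] by (auto simp: compose_def fun_eq_iff)

text \<open>Since \<open>h\<close> maps \<open>U\<close> into \<open>V\<close>, restricting the
  composite of \<open>l\<close> and \<open>k\<close> to \<open>V\<close> loses nothing.\<close>

lemma compose_admissible_assoc:
  "\<lbrakk>U \<in> R; V \<in> R; h \<in> A U V\<rbrakk> \<Longrightarrow> compose U l (compose U k h) = compose U (compose V l k) h"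
  using admissible_map[of U V h] by (auto simp: compose_def fun_eq_iff)

lemma category_Emb: "category (Emb R A)"
  by unfold_locales
    (auto simp: Emb_def admissible_id admissible_comp compose_id_right compose_id_left
      compose_admissible_assoc)

sublocale E: category "Emb R A"
  by (fact category_Emb)

text \<open>In a square the identity sits on an object that equals the required domain or codomain
  only through a boundary equation, so the object is left as a variable \<open>U\<close>.\<close>

lemma comp_id_right_eq: "\<lbrakk>f \<in> Arr (Emb R A); Dom (Emb R A) f = U\<rbrakk> \<Longrightarrow> Comp (Emb R A) f (Id (Emb R A) U) = f"
  and comp_id_left_eq: "\<lbrakk>f \<in> Arr (Emb R A); Cod (Emb R A) f = U\<rbrakk> \<Longrightarrow> Comp (Emb R A) (Id (Emb R A) U) f = f"
  using E.comp_id_right E.comp_id_left by auto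

lemma Inc_arr_Emb: "i \<in> Arr (Inc R A) \<Longrightarrow> i \<in> Arr (Emb R A)"
  by (simp add: Inc_def)

lemma id_Inc: "U \<in> Obj (Emb R A) \<Longrightarrow> Id (Emb R A) U \<in> Arr (Inc R A)"
  using E.id_arr by (auto simp: Inc_def Emb_def is_inclusion_def)

lemma comp_Inc:
  assumes "i \<in> Arr (Inc R A)" "j \<in> Arr (Inc R A)" "Cod (Emb R A) i = Dom (Emb R A) j"
  shows "Comp (Emb R A) j i \<in> Arr (Inc R A)"
proof -
  have "Comp (Emb R A) j i \<in> Arr (Emb R A)"
    using assms by (simp add: E.comp_arr Inc_arr_Emb)
  \<comment> \<open>Points of the domain of \<open>i\<close> lie in its codomain, which is the
    domain of \<open>j\<close>, so both maps fix them.\<close>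
  moreover have "is_inclusion (Comp (Emb R A) j i)"
    using assms by (auto simp: Inc_def Emb_def is_inclusion_def compose_def fun_eq_iff)
  ultimately show ?thesis
    by (simp add: Inc_def)
qed

lemma category_Inc: "category (Inc R A)"
  by unfold_locales
    (auto simp: id_Inc comp_Inc Inc_arr_Emb E.dom_obj E.cod_obj E.dom_id E.cod_id
      E.dom_comp E.cod_comp E.comp_id_right E.comp_id_left E.comp_assoc)

lemma Square_mem_iff:
  "Square h h' i j \<in> Mink_squares R A \<longleftrightarrow>
    h \<in> Arr (Emb R A) \<and> h' \<in> Arr (Emb R A) \<and> i \<in> Arr (Inc R A) \<and> j \<in> Arr (Inc R A) \<and>
    Dom (Emb R A) i = Dom (Emb R A) h \<and> Cod (Emb R A) i = Dom (Emb R A) h' \<and>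
    Dom (Emb R A) j = Cod (Emb R A) h \<and> Cod (Emb R A) j = Cod (Emb R A) h' \<and>
    Comp (Emb R A) j h = Comp (Emb R A) h' i"
  by (simp add: Mink_squares_def)

text \<open>With juxtaposition for composition: \<open>j' j h = j' h' i = h'' i' i\<close>, using
  the upper square and then the lower one.\<close>

lemma paste_vertical:
  assumes "Square h h' i j \<in> Mink_squares R A" "Square h' h'' i' j' \<in> Mink_squares R A"
  shows "Square h h'' (Comp (Emb R A) i' i) (Comp (Emb R A) j' j) \<in> Mink_squares R A"
proof -
  note sq = assms[unfolded Square_mem_iff]
  have "Comp (Emb R A) (Comp (Emb R A) j' j) h = Comp (Emb R A) j' (Comp (Emb R A) j h)"
    using sq by (intro E.comp_assoc[symmetric]) (simp_all add: Inc_arr_Emb)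
  also have "\<dots> = Comp (Emb R A) j' (Comp (Emb R A) h' i)"
    using sq by (simp only:)
  also have "\<dots> = Comp (Emb R A) (Comp (Emb R A) j' h') i"
    using sq by (intro E.comp_assoc) (simp_all add: Inc_arr_Emb)
  also have "\<dots> = Comp (Emb R A) (Comp (Emb R A) h'' i') i"
    using sq by (simp only:)
  also have "\<dots> = Comp (Emb R A) h'' (Comp (Emb R A) i' i)"
    using sq by (intro E.comp_assoc[symmetric]) (simp_all add: Inc_arr_Emb)
  finally show ?thesis
    using sq by (simp add: Square_mem_iff comp_Inc Inc_arr_Emb E.dom_comp E.cod_comp)
qed

text \<open>Here the squares share the side \<open>j\<close>, and
  \<open>l k h = k' j h = k' h' i\<close>, using the right square and then the left one.\<close>

lemma paste_horizontal:
  assumes "Square h h' i j \<in> Mink_squares R A" "Square k k' j l \<in> Mink_squares R A"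
  shows "Square (Comp (Emb R A) k h) (Comp (Emb R A) k' h') i l \<in> Mink_squares R A"
proof -
  note sq = assms[unfolded Square_mem_iff]
  have "Comp (Emb R A) l (Comp (Emb R A) k h) = Comp (Emb R A) (Comp (Emb R A) l k) h"
    using sq by (intro E.comp_assoc) (simp_all add: Inc_arr_Emb)
  also have "\<dots> = Comp (Emb R A) (Comp (Emb R A) k' j) h"
    using sq by (simp only:)
  also have "\<dots> = Comp (Emb R A) k' (Comp (Emb R A) j h)"
    using sq by (intro E.comp_assoc[symmetric]) (simp_all add: Inc_arr_Emb)
  also have "\<dots> = Comp (Emb R A) k' (Comp (Emb R A) h' i)"
    using sq by (simp only:)
  also have "\<dots> = Comp (Emb R A) (Comp (Emb R A) k' h') i"
    using sq by (intro E.comp_assoc) (simp_all add: Inc_arr_Emb)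
  finally show ?thesis
    using sq by (simp add: Square_mem_iff E.comp_arr Inc_arr_Emb E.dom_comp E.cod_comp)
qed

lemma Mink1_sel [simp]:
  "Obj (Mink1 R A) = Arr (Emb R A)" "Arr (Mink1 R A) = Mink_squares R A"
  "Dom (Mink1 R A) = sq_top" "Cod (Mink1 R A) = sq_bottom"
  "Id (Mink1 R A) h = Square h h (Id (Emb R A) (Dom (Emb R A) h)) (Id (Emb R A) (Cod (Emb R A) h))"
  "Comp (Mink1 R A) b a = Square (sq_top a) (sq_bottom b)
    (Comp (Emb R A) (sq_left b) (sq_left a)) (Comp (Emb R A) (sq_right b) (sq_right a))"
  by (simp_all add: Mink1_def)

lemma identity_square:
  "h \<in> Arr (Emb R A) \<Longrightarrow>
    Square h h (Id (Emb R A) (Dom (Emb R A) h)) (Id (Emb R A) (Cod (Emb R A) h)) \<in> Mink_squares R A"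
  by (simp add: Square_mem_iff id_Inc E.dom_obj E.cod_obj E.dom_id E.cod_id
      E.comp_id_left E.comp_id_right)

lemma unit_square:
  "i \<in> Arr (Inc R A) \<Longrightarrow>
    Square (Id (Emb R A) (Dom (Emb R A) i)) (Id (Emb R A) (Cod (Emb R A) i)) i i \<in> Mink_squares R A"
  by (simp add: Square_mem_iff Inc_arr_Emb E.id_arr E.dom_obj E.cod_obj E.dom_id E.cod_id
      E.comp_id_left E.comp_id_right)

text \<open>Vertical composition composes the left sides and the right sides separately, so the unit
  and associativity laws are those of \<open>Emb R A\<close> on each side.\<close>

lemma category_Mink1: "category (Mink1 R A)"
proof (unfold_locales, goal_cases)
  case (3 h) then show ?case
    by (simp add: identity_square)
next
  case (6 a b) then show ?case
    by (cases a; cases b) (simp add: paste_vertical)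
next
  case (9 a) then show ?case
    by (cases a) (auto simp: Square_mem_iff Inc_arr_Emb comp_id_right_eq)
next
  case (10 a) then show ?case
    by (cases a) (auto simp: Square_mem_iff Inc_arr_Emb comp_id_left_eq)
next
  case (11 a b d) then show ?case
    by (cases a; cases b; cases d) (simp add: Square_mem_iff Inc_arr_Emb E.comp_assoc)
qed (auto simp: Mink_squares_def)

lemma Mink_sel [simp]:
  "D0 (Mink R A) = Inc R A" "D1 (Mink R A) = Mink1 R A"
  "on_obj (src (Mink R A)) = Dom (Emb R A)" "on_arr (src (Mink R A)) = sq_left"
  "on_obj (tgt (Mink R A)) = Cod (Emb R A)" "on_arr (tgt (Mink R A)) = sq_right"
  "on_obj (unit (Mink R A)) = Id (Emb R A)"
  "on_arr (unit (Mink R A)) i =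
    Square (Id (Emb R A) (Dom (Emb R A) i)) (Id (Emb R A) (Cod (Emb R A) i)) i i"
  "on_obj (hcomp (Mink R A)) (k, h) = Comp (Emb R A) k h"
  "on_arr (hcomp (Mink R A)) (b, a) = Square (Comp (Emb R A) (sq_top b) (sq_top a))
    (Comp (Emb R A) (sq_bottom b) (sq_bottom a)) (sq_left a) (sq_right b)"
  by (simp_all add: Mink_def)

lemma cat_functor_src: "cat_functor (Mink1 R A) (Inc R A) (src (Mink R A))"
  by (intro cat_functor.intro category_Mink1 category_Inc, unfold_locales)
    (auto simp: Mink_squares_def E.dom_obj)

lemma cat_functor_tgt: "cat_functor (Mink1 R A) (Inc R A) (tgt (Mink R A))"
  by (intro cat_functor.intro category_Mink1 category_Inc, unfold_locales)
    (auto simp: Mink_squares_def E.cod_obj)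

lemma cat_functor_unit: "cat_functor (Inc R A) (Mink1 R A) (unit (Mink R A))"
  by (intro cat_functor.intro category_Mink1 category_Inc, unfold_locales)
    (auto simp: unit_square E.id_arr E.dom_id E.cod_id E.dom_comp E.cod_comp Inc_arr_Emb)

text \<open>Preservation of composition is the interchange law; it holds by comparing the four
  sides.\<close>

lemma cat_functor_hcomp:
  "cat_functor (pullback_cat (Mink1 R A) (src (Mink R A)) (tgt (Mink R A)) (Mink1 R A)) (Mink1 R A)
    (hcomp (Mink R A))"
proof (intro cat_functor.intro category_Mink1 category_pullback_cat[OF cat_functor_src cat_functor_tgt],
    unfold_locales, goal_cases)
  case (2 f)
  \<comment> \<open>Membership in the pullback identifies the left side of \<open>b\<close> with the
    right side of \<open>a\<close>: the common edge for pasting.\<close>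
  then obtain b a where f: "f = (b, a)" "b \<in> Mink_squares R A" "a \<in> Mink_squares R A"
    "sq_left b = sq_right a"
    by (auto simp: pullback_cat_def)
  then show ?case
    by (cases a; cases b) (simp add: paste_horizontal)
qed (auto simp: pullback_cat_def E.comp_arr E.dom_comp E.cod_comp)

text \<open>Horizontal associativity and unit laws for squares are those of \<open>Emb R A\<close>
  on top and bottom; the outer vertical sides are carried along unchanged.\<close>

lemma strict_double_category_Mink: "strict_double_category (Mink R A)"
  by (intro strict_double_category.intro strict_double_category_axioms.intro)
    (auto simp: category_Inc category_Mink1 cat_functor_src cat_functor_tgt cat_functor_unit
      cat_functor_hcomp Mink_squares_def E.dom_id E.cod_id E.dom_comp E.cod_comp E.comp_assoc
      comp_id_left_eq comp_id_right_eq)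

end

theorem lemma3p3:
  fixes M :: "'a topology"
    and R :: "'a set set"
    and A :: "'a set \<Rightarrow> 'a set \<Rightarrow> ('a \<Rightarrow> 'a) set"
  assumes "spacetime_regions M R A"
  shows "strict_double_category (Mink R A)"
  using assms by (rule spacetime_regions.strict_double_category_Mink)

end
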